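(* Let $X$ be a real or complex locally convex space endowed with a saturated family $\{\|\cdot\|_\lambda\}_{\lambda\in\Lambda}$ of seminorms defining the topology of $X$. Let $D$ be a bounded, closed and convex subset of $X$ and let $T:D\to\mathcal{Q}(D)$ be a condensing multi-function. Then $T$ has a fixed point, i.e. there is $x\in D$ with $x\in Tx$.
   Context: Put $d_\lambda(x,y)=\|x-y\|_\lambda$ for $x,y\in X$; saturated means that for all $\lambda,\mu\in\Lambda$ there is $\nu\in\Lambda$ with $\max\{d_\lambda(x,y),d_\mu(x,y)\}\le d_\nu(x,y)$ for all $x,y\in X$. $\mathcal{Q}(D)$ is the family of all nonempty, compact, convex subsets of $D$. A set $B\subseteq X$ is bounded if there exist $x\in X$ and an entourage $U$ of the uniformity generated by $\{d_\lambda\}_{\lambda\in\Lambda}$ such that $B\subseteq U[x]=\{y\in X:(x,y)\in U\}$; $\mathcal{B}(X)$ is the family of all bounded subsets of $X$. Write $\mathrm{B}_\lambda(a,\epsilon)=\{x\in X:d_\lambda(a,x)<\epsilon\}$. The non-compactness measure $\alpha:\mathcal{B}(X)\to[0,\infty[$ is defined by letting $\alpha(A)$ be the infimum of all $\epsilon>0$ such that for each $\lambda\in\Lambda$ there exist $x_1,\dots,x_r\in X$ with $A\subseteq\mathrm{B}_\lambda(x_1,\epsilon/2)\cup\cdots\cup\mathrm{B}_\lambda(x_r,\epsilon/2)$. For $A\subseteq D$, $T(A)=\bigcup_{x\in A}Tx$. $T$ is condensing if $T$ is continuous and for each $A\subseteq D$ such that $A\in\mathcal{B}(X)$ and $\alpha(A)>0$,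 one has $T(A)\in\mathcal{B}(X)$ and $\alpha(T(A))<\alpha(A)$. Continuity of $T$ is with respect to the topology on sets generated by the Hausdorff pseudometrics $H^\lambda(A,B)=\max\{\sup_{x\in A}d_\lambda(x,B),\sup_{y\in B}d_\lambda(y,A)\}$, $\lambda\in\Lambda$, where $d_\lambda(a,A)=\inf_{x\in A}d_\lambda(a,x)$.
   Formalization: The formal theorem additionally assumes that D is complete (automatic if X is complete or quasi-complete), that X is Hausdorff and that D is nonempty; without any one of these the claim as stated is false. *)

theory Defs
  imports "HOL-Analysis.Analysis"
begin

definition seminorm_dist :: "('i \<Rightarrow> 'a::real_vector \<Rightarrow> real) \<Rightarrow> 'i \<Rightarrow> 'a \<Rightarrow> 'a \<Rightarrow> real"
  where "seminorm_dist p i x y = p i (x - y)"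

definition seminorm_ball :: "('i \<Rightarrow> 'a::real_vector \<Rightarrow> real) \<Rightarrow> 'i \<Rightarrow> 'a \<Rightarrow> real \<Rightarrow> 'a set"
  where "seminorm_ball p i a e = {x. seminorm_dist p i a x < e}"

(* The scalars are the real or the complex numbers: up to isomorphism these are the only
   instances of real_normed_field.  The real structure underlying the scalar multiplication is
   that of the class real_vector, so that the library notion of convexity applies. The last
   assumption says that the uniformity, and hence (by the class law) the topology, of the type is
   the one generated by the seminorms. The space is Hausdorff by class t2_space. *)
locale saturated_lcs = vector_space scale
  for scale :: "'k::real_normed_field \<Rightarrow> 'a::{real_vector, uniform_space, t2_space} \<Rightarrow> 'a" +
  fixes I :: "'i set" and p :: "'i \<Rightarrow> 'a \<Rightarrow> real"
  assumes scale_of_real: "scale (of_real r) x = r *\<^sub>R x"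
    and seminorm_triangle: "i \<in> I \<Longrightarrow> p i (x + y) \<le> p i x + p i y"
    and seminorm_scale: "i \<in> I \<Longrightarrow> p i (scale c x) = norm c * p i x"
    and saturated: "i \<in> I \<Longrightarrow> j \<in> I \<Longrightarrow>
      \<exists>k\<in>I. \<forall>x y. max (seminorm_dist p i x y) (seminorm_dist p j x y) \<le> seminorm_dist p k x y"
    and uniformity_seminorms:
      "uniformity = (INF i\<in>I. INF e\<in>{0<..}. principal {(x, y). seminorm_dist p i x y < e})"

(* All entourages are allowed, including UNIV, so in this literal reading every set is bounded. *)
definition unif_bounded :: "'a::uniform_space set \<Rightarrow> bool"
  where "unif_bounded B \<longleftrightarrow> (\<exists>x U. (\<forall>\<^sub>F z in uniformity. z \<in> U) \<and> B \<subseteq> U `` {x})"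

definition compact_convex_subsets :: "'a::{real_vector, topological_space} set \<Rightarrow> 'a set set"
  where "compact_convex_subsets D = {A. A \<subseteq> D \<and> A \<noteq> {} \<and> compact A \<and> convex A}"

(* Extended values: the measure is infinity if no radius works uniformly in the seminorms. *)
definition noncompactness ::
    "'i set \<Rightarrow> ('i \<Rightarrow> 'a::real_vector \<Rightarrow> real) \<Rightarrow> 'a set \<Rightarrow> ennreal"
  where "noncompactness I p A =
    Inf {ennreal e | e. e > 0 \<and>
      (\<forall>i\<in>I. \<exists>F. finite F \<and> A \<subseteq> (\<Union>x\<in>F. seminorm_ball p i x (e / 2)))}"

definition dist_to_set :: "('i \<Rightarrow> 'a::real_vector \<Rightarrow> real) \<Rightarrow> 'i \<Rightarrow> 'a \<Rightarrow> 'a set \<Rightarrow> real"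
  where "dist_to_set p i a A = (INF x\<in>A. seminorm_dist p i a x)"

definition hausdorff_pdist :: "('i \<Rightarrow> 'a::real_vector \<Rightarrow> real) \<Rightarrow> 'i \<Rightarrow> 'a set \<Rightarrow> 'a set \<Rightarrow> real"
  where "hausdorff_pdist p i A B =
    max (SUP x\<in>A. dist_to_set p i x B) (SUP y\<in>B. dist_to_set p i y A)"

(* The carrier is listed among the generators so that the topspace is right for empty I, too. *)
definition hausdorff_topology ::
    "'i set \<Rightarrow> ('i \<Rightarrow> 'a::{real_vector, topological_space} \<Rightarrow> real) \<Rightarrow> 'a set \<Rightarrow> 'a set topology"
  where "hausdorff_topology I p D = topology_generated_by
    (insert (compact_convex_subsets D)
      {{B \<in> compact_convex_subsets D. hausdorff_pdist p i A B < e} | A i e.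
        A \<in> compact_convex_subsets D \<and> i \<in> I \<and> e > 0})"

definition condensing ::
    "'i set \<Rightarrow> ('i \<Rightarrow> 'a::{real_vector, uniform_space} \<Rightarrow> real) \<Rightarrow> 'a set \<Rightarrow> ('a \<Rightarrow> 'a set) \<Rightarrow> bool"
  where "condensing I p D T \<longleftrightarrow>
    continuous_map (top_of_set D) (hausdorff_topology I p D) T \<and>
    (\<forall>A\<subseteq>D. unif_bounded A \<and> noncompactness I p A > 0 \<longrightarrow>
      unif_bounded (\<Union>x\<in>A. T x) \<and> noncompactness I p (\<Union>x\<in>A. T x) < noncompactness I p A)"

end

theory Submission
  imports Defs
begin

text \<open>
  Fix \<open>x\<^sub>0 \<in> D\<close> and let \<open>C\<close> be the least closed convex subset of \<open>D\<close> that contains \<open>x\<^sub>0\<close> and is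
  invariant under \<open>T\<close>. For finite \<open>F\<close> the set of points within seminorm distance \<open>e/2\<close> of the
  compact hull of \<open>F \<union> {x\<^sub>0}\<close> is closed and convex; if it contains \<open>T(C)\<close>, then by minimality it
  contains \<open>C\<close>. Hence \<open>\<alpha>(C) \<le> \<alpha>(T(C))\<close>, so \<open>\<alpha>(C) = 0\<close> because \<open>T\<close> is condensing, and \<open>C\<close> is
  compact.

  On \<open>C\<close>, Hausdorff continuity makes \<open>x \<mapsto> d\<^sub>\<lambda>(y, T x)\<close> continuous. A partition of unity built
  from these functions gives a continuous approximate selection of \<open>T\<close> with values in a simplex,
  and Brouwer's theorem yields \<open>x\<close> with \<open>d\<^sub>\<lambda>(x, T x) < \<epsilon>\<close>. Compactness of \<open>C\<close> and saturation give
  one \<open>x\<close> that serves all \<open>\<lambda>\<close> and \<open>\<epsilon>\<close>.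
\<close>

section \<open>Compactness in uniform spaces\<close>

text \<open>A filter minimal among the proper filters below \<open>F\<close>, found by Zorn's lemma,
  decides every \<open>P\<close>: meeting it with \<open>P\<close> gives either \<open>bot\<close>,
  so \<open>P\<close> fails eventually, or by minimality the same filter, so \<open>P\<close> holds
  eventually.\<close>

lemma ultrafilter_exists:
  assumes "F \<noteq> bot"
  shows "\<exists>G\<le>F. G \<noteq> bot \<and> (\<forall>P. eventually P G \<or> (\<forall>\<^sub>F x in G. \<not> P x))"
proof -
  let ?A = "{G. G \<le> F \<and> G \<noteq> bot}"
  have "\<exists>M\<in>?A. \<forall>G\<in>?A. M \<ge> G \<longrightarrow> G = M"
  proof (rule predicate_Zorn)
    show "partial_order_on ?A (relation_of (\<lambda>x y. y \<le> x) ?A)"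
      by (auto simp: partial_order_on_def preorder_on_def relation_of_def refl_on_def trans_def
          antisym_def)
  next
    fix C assume "C \<in> Chains (relation_of (\<lambda>x y. y \<le> x) ?A)"
    then have C: "C \<subseteq> ?A" and chain: "\<And>G H. G \<in> C \<Longrightarrow> H \<in> C \<Longrightarrow> G \<le> H \<or> H \<le> G"
      by (auto simp: Chains_def relation_of_def)
    show "\<exists>u\<in>?A. \<forall>a\<in>C. u \<le> a"
    proof (cases "C = {}")
      case True
      then show ?thesis using assms by auto
    next
      case False
      \<comment> \<open>A chain is directed downwards, so whatever holds eventually along its
        infimum already holds along one member; hence the infimum stays proper.\<close>
      have "eventually P (Inf C) \<longleftrightarrow> (\<exists>b\<in>C. eventually P b)" for P
        using False by (rule eventually_Inf_base) (metis chain inf.absorb1 inf.absorb2 order_refl)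
      then have "Inf C \<noteq> bot"
        using C by (auto simp: trivial_limit_def)
      moreover have "Inf C \<le> F"
        using False C by (metis (mono_tags, lifting) Inf_lower2 ex_in_conv mem_Collect_eq subsetD)
      ultimately show ?thesis
        by (auto intro: Inf_lower)
    qed
  qed
  then obtain G where G: "G \<le> F" "G \<noteq> bot" and min: "\<And>H. H \<le> F \<Longrightarrow> H \<noteq> bot \<Longrightarrow> H \<le> G \<Longrightarrow> H = G"
    by auto
  have "eventually P G \<or> (\<forall>\<^sub>F x in G. \<not> P x)" for P
  proof (cases "inf G (principal {x. P x}) = bot")
    case True
    then show ?thesis
      by (simp add: trivial_limit_def eventually_inf_principal)
  next
    case False
    then have "inf G (principal {x. P x}) = G"
      by (intro min) (auto intro: le_infI1 G)
    then have "G \<le> principal {x. P x}"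
      by (metis inf_le2)
    then show ?thesis
      by (simp add: le_principal)
  qed
  with G show ?thesis by blast
qed

text \<open>An ultrafilter finer than \<open>F\<close> picks one set from every finite cover of
  \<open>S\<close> by small sets, so it is Cauchy. By completeness it converges, and the limit of
  the finer filter is a cluster point of \<open>F\<close>.\<close>

lemma complete_totally_bounded_imp_compact:
  fixes S :: "'a::uniform_space set"
  assumes "complete S" and tb: "totally_bounded S"
  shows "compact S"
  unfolding compact_filter
proof (intro allI impI)
  fix F :: "'a filter"
  assume "F \<noteq> bot" and "eventually (\<lambda>x. x \<in> S) F"
  from ultrafilter_exists[OF \<open>F \<noteq> bot\<close>] obtain G where G: "G \<le> F" "G \<noteq> bot"
    and ultra: "\<And>P. eventually P G \<or> (\<forall>\<^sub>F x in G. \<not> P x)"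
    by blast
  have GS: "eventually (\<lambda>x. x \<in> S) G"
    using G \<open>eventually (\<lambda>x. x \<in> S) F\<close> by (auto simp: le_filter_def)
  have "\<exists>P. eventually P G \<and> (\<forall>x y. P x \<longrightarrow> P y \<longrightarrow> E (x, y))" if "eventually E uniformity" for E
  proof -
    from that obtain D where D: "eventually D uniformity"
      and DE: "\<And>x y z. D (x, y) \<Longrightarrow> D (y, z) \<Longrightarrow> E (x, z)"
      by (rule uniformity_transE) blast
    \<comment> \<open>Symmetrised half-size entourage: two points that are \<open>?D\<close>-close
      to the same centre are \<open>E\<close>-close to each other.\<close>
    let ?D = "\<lambda>(x, y). D (x, y) \<and> D (y, x)"
    have "eventually ?D uniformity"
      using D uniformity_sym[OF D] by (auto elim: eventually_elim2)
    from tb[unfolded totally_bounded_def, rule_format, OF this]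
    obtain X where X: "finite X" "\<forall>s\<in>S. \<exists>x\<in>X. ?D (x, s)"
      by blast
    have "\<exists>x\<in>X. eventually (\<lambda>s. ?D (x, s)) G"
    proof (rule ccontr)
      assume "\<not> ?thesis"
      then have "\<forall>x\<in>X. eventually (\<lambda>s. \<not> ?D (x, s)) G"
        using ultra by blast
      then have "eventually (\<lambda>s. \<forall>x\<in>X. \<not> ?D (x, s)) G"
        using X(1) by (simp add: eventually_ball_finite_distrib)
      with GS have "eventually (\<lambda>s. False) G"
        by eventually_elim (use X(2) in blast)
      with G(2) show False by (simp add: trivial_limit_def)
    qed
    then obtain x where "eventually (\<lambda>s. ?D (x, s)) G" by blast
    then show ?thesis
      using DE by (intro exI[of _ "\<lambda>s. ?D (x, s)"]) auto
  qed
  then have "cauchy_filter G"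
    unfolding cauchy_filter_def le_filter_def eventually_prod_same by metis
  then obtain x where "x \<in> S" "G \<le> nhds x"
    using \<open>complete S\<close> G(2) GS unfolding complete_uniform le_principal by blast
  then show "\<exists>x\<in>S. inf (nhds x) F \<noteq> bot"
    using G by (metis bot.extremum_uniqueI inf.boundedI)
qed

lemma complete_closed_subset:
  fixes S :: "'a::uniform_space set"
  assumes "complete D" "closed S" "S \<subseteq> D"
  shows "complete S"
  unfolding complete_uniform
proof (intro allI impI)
  fix F :: "'a filter"
  assume F: "F \<le> principal S" "F \<noteq> bot" "cauchy_filter F"
  then have "F \<le> principal D"
    using assms(3) by (meson order_trans principal_le_iff)
  then obtain x where x: "x \<in> D" "F \<le> nhds x"
    using assms(1) F unfolding complete_uniform by blast
  have "x \<in> S"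
  proof (rule ccontr)
    assume "x \<notin> S"
    then have "eventually (\<lambda>y. y \<in> - S) (nhds x)"
      using assms(2) by (intro eventually_nhds_in_open) auto
    then have "eventually (\<lambda>y. y \<in> - S) F"
      using x(2) by (simp add: le_filter_def)
    moreover have "eventually (\<lambda>y. y \<in> S) F"
      using F(1) by (simp add: le_principal)
    ultimately have "eventually (\<lambda>y. False) F"
      by eventually_elim simp
    then show False
      using F(2) by (simp add: trivial_limit_def)
  qed
  with x show "\<exists>x\<in>S. F \<le> nhds x" by blast
qed

section \<open>Brouwer's theorem for cubes of variable dimension\<close>

lemma tendsto_coordinatewise_iff:
  fixes f :: "'b \<Rightarrow> 'i \<Rightarrow> 'c::topological_space"
  shows "(f \<longlongrightarrow> l) F \<longleftrightarrow> (\<forall>i. ((\<lambda>x. f x i) \<longlongrightarrow> l i) F)"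
  using limitin_componentwise[of "\<lambda>_. euclidean" UNIV f l F]
  by (simp add: euclidean_product_topology)

text \<open>
  The dimension of the simplices below depends on data of the proof, so it cannot be a type as in
  the library version of Brouwer's theorem; Kuhn's combinatorial lemma is indexed by \<open>nat\<close>.
\<close>

definition nat_cube :: "nat \<Rightarrow> (nat \<Rightarrow> real) set"
  where "nat_cube n = {x. (\<forall>i<n. x i \<in> {0..1}) \<and> (\<forall>i\<ge>n. x i = 0)}"

text \<open>Fixing the coordinates from \<open>n\<close> on at 0 makes the cube a full product over
  all natural numbers with compact factors, so Tychonoff's theorem applies.\<close>

lemma compact_nat_cube: "compact (nat_cube n)"
proof -
  have "nat_cube n = PiE UNIV (\<lambda>i. if i < n then {0..1} else {0})"
    unfolding nat_cube_def PiE_UNIV_domain Pi_def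
    by (intro Collect_cong) (simp add: if_split[where P = "\<lambda>A. _ \<in> A"] all_conj_distrib not_less)
  moreover have "compactin (product_topology (\<lambda>_. euclidean) UNIV)
      (PiE UNIV (\<lambda>i::nat. if i < n then {0..1} else {0::real}))"
    unfolding compactin_PiE by auto
  ultimately show ?thesis
    by (simp add: euclidean_product_topology)
qed

text \<open>Kuhn's lemma on the grid of mesh \<open>1 / Suc m\<close> yields a cell where, for each
  coordinate \<open>i\<close>, one vertex is not moved down and another is not moved up in direction
  \<open>i\<close>. Along a subsequence the cells shrink to a point \<open>x\<close>, and continuity
  gives both inequalities between \<open>f x i\<close> and \<open>x i\<close>.\<close>

theorem brouwer_nat_cube:
  assumes cont: "continuous_on (nat_cube n) f" and f: "f \<in> nat_cube n \<rightarrow> nat_cube n"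
  shows "\<exists>x\<in>nat_cube n. f x = x"
proof -
  define g :: "nat \<Rightarrow> (nat \<Rightarrow> nat) \<Rightarrow> nat \<Rightarrow> real"
    where "g = (\<lambda>m q i. if i < n then real (q i) / real (Suc m) else 0)"
  have g_cube: "g m q \<in> nat_cube n" if "\<forall>i<n. q i \<le> Suc m" for m q
    using that by (auto simp: g_def nat_cube_def divide_simps simp del: of_nat_Suc)
  have "\<exists>q. (\<forall>i<n. q i < Suc m) \<and>
     (\<forall>i<n. \<exists>r s. g m r \<in> nat_cube n \<and> g m s \<in> nat_cube n
       \<and> (\<forall>j. \<bar>g m r j - g m q j\<bar> \<le> 1 / Suc m) \<and> (\<forall>j. \<bar>g m s j - g m q j\<bar> \<le> 1 / Suc m)
       \<and> g m r i \<le> f (g m r) i \<and> f (g m s) i \<le> g m s i)" for m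
  proof -
    \<comment> \<open>Label 1 stands for a coordinate that \<open>f\<close> decreases. The top face
      gets it by decree, as Kuhn's lemma demands; \<open>l1\<close> stays true there because the
      coordinate is 1 and \<open>f\<close> maps into the cube.\<close>
    define label where
      "label = (\<lambda>q i. if q i = Suc m \<or> f (g m q) i < g m q i then 1 else (0::nat))"
    have l01: "label q i = 0 \<or> label q i = 1" for q i
      by (simp add: label_def)
    have l0: "g m q i \<le> f (g m q) i" if "label q i = 0" for q i
      using that by (auto simp: label_def split: if_splits)
    have l1: "f (g m q) i \<le> g m q i" if "label q i \<noteq> 0" "\<forall>i<n. q i \<le> Suc m" "i < n" for q i
    proof (cases "q i = Suc m")
      case True
      then have "g m q i = 1"
        using that by (simp add: g_def del: of_nat_Suc)
      moreover have "f (g m q) \<in> nat_cube n"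
        using g_cube[OF that(2)] f by blast
      ultimately show ?thesis
        using that(3) by (auto simp: nat_cube_def)
    next
      case False
      then show ?thesis
        using that by (auto simp: label_def split: if_splits)
    qed
    have l00: "label q i = 0" if "\<forall>i<n. q i \<le> Suc m" "i < n" "q i = 0" for q i
    proof -
      have "f (g m q) \<in> nat_cube n"
        using g_cube[OF that(1)] f by blast
      then show ?thesis
        using that by (auto simp: label_def g_def nat_cube_def)
    qed
    obtain q where q: "\<forall>i<n. q i < Suc m"
      and rs: "\<forall>i<n. \<exists>r s. (\<forall>j<n. q j \<le> r j \<and> r j \<le> q j + 1) \<and> (\<forall>j<n. q j \<le> s j \<and> s j \<le> q j + 1)
        \<and> label r i \<noteq> label s i"
      by (rule kuhn_lemma[of "Suc m" n label]) (use l00 in \<open>auto simp: label_def\<close>)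
    have near: "\<bar>g m r j - g m q j\<bar> \<le> 1 / Suc m" if "\<forall>j<n. q j \<le> r j \<and> r j \<le> q j + 1" for r j
      using that[rule_format, of j]
      by (auto simp: g_def abs_le_iff simp flip: diff_divide_distrib minus_divide_left
          intro!: divide_right_mono)
    have le: "\<forall>j<n. r j \<le> Suc m" if "\<forall>j<n. q j \<le> r j \<and> r j \<le> q j + 1" for r
      using q that by fastforce
    have "\<exists>r s. g m r \<in> nat_cube n \<and> g m s \<in> nat_cube n
       \<and> (\<forall>j. \<bar>g m r j - g m q j\<bar> \<le> 1 / Suc m) \<and> (\<forall>j. \<bar>g m s j - g m q j\<bar> \<le> 1 / Suc m)
       \<and> g m r i \<le> f (g m r) i \<and> f (g m s) i \<le> g m s i" (is "\<exists>r s. ?Q r s") if i: "i < n" for i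
    proof -
      obtain r s where near_q: "\<forall>j<n. q j \<le> r j \<and> r j \<le> q j + 1" "\<forall>j<n. q j \<le> s j \<and> s j \<le> q j + 1"
        and "label r i \<noteq> label s i"
        using rs i by blast
      \<comment> \<open>Kuhn's lemma does not say which of the two vertices carries label 0, so both
        assignments of roles are treated.\<close>
      then have "label r i = 0 \<and> label s i \<noteq> 0 \<or> label s i = 0 \<and> label r i \<noteq> 0"
        by (metis l01)
      moreover have Q: "?Q t u" if t: "\<forall>j<n. q j \<le> t j \<and> t j \<le> q j + 1" "label t i = 0"
        and u: "\<forall>j<n. q j \<le> u j \<and> u j \<le> q j + 1" "label u i \<noteq> 0" for t u
        using near[OF t(1)] near[OF u(1)] g_cube[OF le[OF t(1)]] g_cube[OF le[OF u(1)]]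
          l0[OF t(2)] l1[OF u(2) le[OF u(1)] i] by simp
      ultimately show ?thesis
      proof (elim disjE conjE)
        assume "label r i = 0" "label s i \<noteq> 0"
        with Q near_q show ?thesis by (intro exI[of _ r] exI[of _ s])
      next
        assume "label s i = 0" "label r i \<noteq> 0"
        with Q near_q show ?thesis by (intro exI[of _ s] exI[of _ r])
      qed
    qed
    with q show ?thesis by blast
  qed
  then obtain q where q: "\<And>m. \<forall>i<n. q m i < Suc m"
    and rs: "\<And>m i. i < n \<Longrightarrow> \<exists>r s. g m r \<in> nat_cube n \<and> g m s \<in> nat_cube n
       \<and> (\<forall>j. \<bar>g m r j - g m (q m) j\<bar> \<le> 1 / Suc m) \<and> (\<forall>j. \<bar>g m s j - g m (q m) j\<bar> \<le> 1 / Suc m)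
       \<and> g m r i \<le> f (g m r) i \<and> f (g m s) i \<le> g m s i"
    by metis
  define y where "y m = g m (q m)" for m
  have "y m \<in> nat_cube n" for m
    unfolding y_def using q[of m] by (intro g_cube) (auto intro: less_imp_le)
  then obtain x k where x: "x \<in> nat_cube n" and k: "strict_mono k" and lim: "(y \<circ> k) \<longlonglongrightarrow> x"
    using compact_imp_seq_compact[OF compact_nat_cube] unfolding seq_compact_def by metis
  have k0: "(\<lambda>m. 1 / real (Suc (k m))) \<longlonglongrightarrow> 0"
    using LIMSEQ_subseq_LIMSEQ[OF LIMSEQ_inverse_real_of_nat k] by (simp add: o_def inverse_eq_divide)
  \<comment> \<open>Cube points within the mesh of \<open>y (k m)\<close> have the same limit
    \<open>x\<close>; this is applied below to both vertices of each cell.\<close>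
  have close: "((\<lambda>m. f (z m) i) \<longlonglongrightarrow> f x i) \<and> ((\<lambda>m. z m i) \<longlonglongrightarrow> x i)"
    if z: "\<And>m. z m \<in> nat_cube n" "\<And>m j. \<bar>z m j - y (k m) j\<bar> \<le> 1 / Suc (k m)" for z i
  proof -
    have "(\<lambda>m. z m j) \<longlonglongrightarrow> x j" for j
    proof -
      have "(\<lambda>m. z m j - y (k m) j) \<longlonglongrightarrow> 0"
        by (rule Lim_null_comparison[OF _ k0]) (use z(2) in auto)
      moreover have "(\<lambda>m. y (k m) j) \<longlonglongrightarrow> x j"
        using lim by (simp add: tendsto_coordinatewise_iff o_def)
      ultimately show ?thesis
        using tendsto_add by fastforce
    qed
    then have "z \<longlonglongrightarrow> x"
      by (simp add: tendsto_coordinatewise_iff)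
    then have "(\<lambda>m. f (z m)) \<longlonglongrightarrow> f x"
      by (rule continuous_on_tendsto_compose[OF cont _ x]) (use z(1) in simp)
    with \<open>z \<longlonglongrightarrow> x\<close> show ?thesis
      by (simp add: tendsto_coordinatewise_iff)
  qed
  have "f x i = x i" for i
  proof (cases "i < n")
    case False
    moreover have "f x \<in> nat_cube n"
      using x f by blast
    ultimately show ?thesis
      using x by (simp add: nat_cube_def)
  next
    case True
    \<comment> \<open>Both vertices are packed into one pair so that a single choice over
      \<open>m\<close> selects them.\<close>
    have "\<forall>m. \<exists>z. fst z \<in> nat_cube n \<and> snd z \<in> nat_cube n
       \<and> (\<forall>j. \<bar>fst z j - y m j\<bar> \<le> 1 / Suc m) \<and> (\<forall>j. \<bar>snd z j - y m j\<bar> \<le> 1 / Suc m)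
       \<and> fst z i \<le> f (fst z) i \<and> f (snd z) i \<le> snd z i" (is "\<forall>m. \<exists>z. ?P m z")
    proof
      fix m
      from rs[OF True, of m] obtain r s where "g m r \<in> nat_cube n \<and> g m s \<in> nat_cube n
         \<and> (\<forall>j. \<bar>g m r j - y m j\<bar> \<le> 1 / Suc m) \<and> (\<forall>j. \<bar>g m s j - y m j\<bar> \<le> 1 / Suc m)
         \<and> g m r i \<le> f (g m r) i \<and> f (g m s) i \<le> g m s i"
        unfolding y_def by blast
      then show "\<exists>z. ?P m z" by (intro exI[of _ "(g m r, g m s)"]) simp
    qed
    from choice[OF this] obtain z where z: "\<forall>m. ?P m (z m)" ..
    then have *: "((\<lambda>m. f (fst (z (k m))) i) \<longlonglongrightarrow> f x i)" "((\<lambda>m. fst (z (k m)) i) \<longlonglongrightarrow> x i)"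
      "((\<lambda>m. f (snd (z (k m))) i) \<longlonglongrightarrow> f x i)" "((\<lambda>m. snd (z (k m)) i) \<longlonglongrightarrow> x i)"
      using close[of "\<lambda>m. fst (z (k m))" i] close[of "\<lambda>m. snd (z (k m))" i] by blast+
    have "x i \<le> f x i"
      by (rule LIMSEQ_le[OF *(2) *(1)]) (use z in auto)
    moreover have "f x i \<le> x i"
      by (rule LIMSEQ_le[OF *(3) *(4)]) (use z in auto)
    ultimately show ?thesis by simp
  qed
  with x show ?thesis by blast
qed

section \<open>Locally convex spaces\<close>

context saturated_lcs
begin

section \<open>Seminorms and the uniformity they generate\<close>

lemma seminorm_scaleR: "i \<in> I \<Longrightarrow> p i (r *\<^sub>R x) = \<bar>r\<bar> * p i x"
  using seminorm_scale[of i "of_real r" x] by (simp add: scale_of_real)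

lemma seminorm_zero: "i \<in> I \<Longrightarrow> p i 0 = 0"
  using seminorm_scaleR[of i 0 0] by simp

lemma seminorm_minus_commute: "i \<in> I \<Longrightarrow> p i (x - y) = p i (y - x)"
  using seminorm_scaleR[of i "-1" "x - y"] by simp

lemma seminorm_nonneg: "i \<in> I \<Longrightarrow> 0 \<le> p i x"
  using seminorm_triangle[of i x "- x"] seminorm_scaleR[of i "-1" x] by (simp add: seminorm_zero)

lemma seminorm_diff_triangle: "i \<in> I \<Longrightarrow> p i (x - z) \<le> p i (x - y) + p i (y - z)"
  using seminorm_triangle[of i "x - y" "y - z"] by simp

text \<open>By saturation the entourages given by one seminorm and one radius form a filter base.
  For empty \<open>I\<close> the infimum is the top filter, for which only the full relation is an
  entourage.\<close>

lemma eventually_uniformity_seminorm: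
  "eventually P uniformity \<longleftrightarrow>
    (if I = {} then \<forall>z. P z else \<exists>i\<in>I. \<exists>e>0. \<forall>x y. p i (x - y) < e \<longrightarrow> P (x, y))"
proof (cases "I = {}")
  case True
  then show ?thesis
    using uniformity_seminorms by (simp add: eventually_top)
next
  case False
  \<comment> \<open>The nested infima become one infimum over pairs of index and radius, the shape
    in which directedness can be checked.\<close>
  let ?F = "\<lambda>z. principal {(x, y). seminorm_dist p (fst z) x y < snd z}"
  have "(uniformity :: ('a \<times> 'a) filter) = (INF z\<in>I \<times> {0<..}. ?F z)"
    unfolding uniformity_seminorms
  proof (intro antisym INF_greatest)
    fix z assume "z \<in> I \<times> {0::real<..}"
    then show "(INF i\<in>I. INF e\<in>{0<..}. principal {(x, y). seminorm_dist p i x y < e}) \<le> ?F z"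
      by (intro INF_lower2[of "fst z"] INF_lower2[of "snd z"]) auto
  next
    fix i and e :: real assume "i \<in> I" "e \<in> {0<..}"
    then show "(INF z\<in>I \<times> {0<..}. ?F z) \<le> principal {(x, y). seminorm_dist p i x y < e}"
      by (intro INF_lower2[of "(i, e)"]) auto
  qed
  moreover have "eventually P (INF z\<in>I \<times> {0<..}. ?F z) \<longleftrightarrow> (\<exists>z\<in>I \<times> {0<..}. eventually P (?F z))"
  proof (rule eventually_INF_base)
    show "I \<times> {0::real<..} \<noteq> {}"
      using False by (auto simp: greaterThan_non_empty)
  next
    fix a b assume "a \<in> I \<times> {0::real<..}" "b \<in> I \<times> {0::real<..}"
    moreover from this obtain k where "k \<in> I"
      "\<forall>x y. max (seminorm_dist p (fst a) x y) (seminorm_dist p (fst b) x y) \<le> seminorm_dist p k x y"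
      using saturated[of "fst a" "fst b"] by auto
    ultimately show "\<exists>z\<in>I \<times> {0<..}. ?F z \<le> inf (?F a) (?F b)"
      by (intro bexI[of _ "(k, min (snd a) (snd b))"]) (auto intro: order_le_less_trans)
  qed
  ultimately show ?thesis
    using False by (auto simp: eventually_principal seminorm_dist_def Bex_def)
qed

lemma eventually_nhds_seminorm:
  "eventually P (nhds x) \<longleftrightarrow>
    (if I = {} then \<forall>y. P y else \<exists>i\<in>I. \<exists>e>0. \<forall>y. p i (x - y) < e \<longrightarrow> P y)"
  unfolding eventually_nhds_uniformity eventually_uniformity_seminorm by auto

text \<open>Reduces convergence in the space to real limits, so that continuity proofs become
  seminorm estimates.\<close>

lemma tendsto_seminorm_iff:
  "(f \<longlongrightarrow> l) F \<longleftrightarrow> (\<forall>i\<in>I. ((\<lambda>x. p i (l - f x)) \<longlongrightarrow> 0) F)"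
proof
  assume f: "(f \<longlongrightarrow> l) F"
  show "\<forall>i\<in>I. ((\<lambda>x. p i (l - f x)) \<longlongrightarrow> 0) F"
  proof
    fix i assume i: "i \<in> I"
    show "((\<lambda>x. p i (l - f x)) \<longlongrightarrow> 0) F"
    proof (rule order_tendstoI)
      fix e :: real assume "0 < e"
      then have "eventually (\<lambda>y. p i (l - y) < e) (nhds l)"
        unfolding eventually_nhds_seminorm using i by auto
      with f show "eventually (\<lambda>x. p i (l - f x) < e) F"
        by (auto simp: filterlim_iff)
    next
      fix e :: real assume "e < 0"
      then show "eventually (\<lambda>x. e < p i (l - f x)) F"
        by (intro always_eventually allI less_le_trans[OF _ seminorm_nonneg[OF i]])
    qed
  qed
next
  assume *: "\<forall>i\<in>I. ((\<lambda>x. p i (l - f x)) \<longlongrightarrow> 0) F"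
  show "(f \<longlongrightarrow> l) F"
    unfolding filterlim_iff eventually_nhds_seminorm
  proof (intro allI impI)
    fix P assume P: "if I = {} then \<forall>y. P y else \<exists>i\<in>I. \<exists>e>0. \<forall>y. p i (l - y) < e \<longrightarrow> P y"
    show "\<forall>\<^sub>F x in F. P (f x)"
    proof (cases "I = {}")
      case False
      with P obtain i e where "i \<in> I" "e > 0" and e: "\<And>y. p i (l - y) < e \<Longrightarrow> P y"
        by auto
      then have "\<forall>\<^sub>F x in F. p i (l - f x) < e"
        using * by (auto dest: order_tendstoD)
      then show ?thesis
        by eventually_elim (rule e)
    qed (use P in simp)
  qed
qed

section \<open>Continuity of the vector operations, and compactness of finite hulls\<close>

lemma tendsto_add_lcs:
  assumes "(f \<longlongrightarrow> a) F" "(g \<longlongrightarrow> b) F"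
  shows "((\<lambda>x. f x + g x) \<longlongrightarrow> (a + b :: 'a)) F"
  unfolding tendsto_seminorm_iff
proof
  fix i assume i: "i \<in> I"
  have "((\<lambda>x. p i (a - f x) + p i (b - g x)) \<longlongrightarrow> 0) F"
    using assms i by (auto simp: tendsto_seminorm_iff intro!: tendsto_add_zero)
  then show "((\<lambda>x. p i (a + b - (f x + g x))) \<longlongrightarrow> 0) F"
  proof (rule Lim_null_comparison[rotated], intro always_eventually allI)
    fix x
    show "norm (p i (a + b - (f x + g x))) \<le> p i (a - f x) + p i (b - g x)"
      using seminorm_triangle[OF i, of "a - f x" "b - g x"] seminorm_nonneg[OF i]
      by (simp add: algebra_simps)
  qed
qed

text \<open>Topology and vector operations of \<open>'a\<close> are linked only through the
  seminorms. Splitting the difference as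
  \<open>(r - c x) *\<^sub>R a + c x *\<^sub>R (a - f x)\<close> bounds it by two terms that tend to
  0.\<close>

lemma tendsto_scaleR_lcs:
  assumes c: "(c \<longlongrightarrow> r) F" and f: "(f \<longlongrightarrow> a) F"
  shows "((\<lambda>x. c x *\<^sub>R f x) \<longlongrightarrow> (r *\<^sub>R a :: 'a)) F"
  unfolding tendsto_seminorm_iff
proof
  fix i assume i: "i \<in> I"
  have "((\<lambda>x. \<bar>r - c x\<bar> * p i a + \<bar>c x\<bar> * p i (a - f x)) \<longlongrightarrow> \<bar>r - r\<bar> * p i a + \<bar>r\<bar> * 0) F"
    using f i by (intro tendsto_intros c) (auto simp: tendsto_seminorm_iff)
  then have "((\<lambda>x. \<bar>r - c x\<bar> * p i a + \<bar>c x\<bar> * p i (a - f x)) \<longlongrightarrow> 0) F"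
    by simp
  then show "((\<lambda>x. p i (r *\<^sub>R a - c x *\<^sub>R f x)) \<longlongrightarrow> 0) F"
  proof (rule Lim_null_comparison[rotated], intro always_eventually allI)
    fix x
    have "r *\<^sub>R a - c x *\<^sub>R f x = (r - c x) *\<^sub>R a + c x *\<^sub>R (a - f x)"
      by (simp add: algebra_simps)
    then show "norm (p i (r *\<^sub>R a - c x *\<^sub>R f x)) \<le> \<bar>r - c x\<bar> * p i a + \<bar>c x\<bar> * p i (a - f x)"
      using seminorm_triangle[OF i, of "(r - c x) *\<^sub>R a" "c x *\<^sub>R (a - f x)"] seminorm_nonneg[OF i]
      by (simp add: seminorm_scaleR[OF i])
  qed
qed

lemma tendsto_sum_lcs:
  "(\<And>j. j \<in> J \<Longrightarrow> (f j \<longlongrightarrow> a j) F) \<Longrightarrow> ((\<lambda>x. \<Sum>j\<in>J. f j x) \<longlongrightarrow> (\<Sum>j\<in>J. a j :: 'a)) F"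
  by (induction J rule: infinite_finite_induct) (auto intro: tendsto_add_lcs)

text \<open>Induction on the set: for nonempty \<open>S\<close>, the hull of
  \<open>insert a S\<close> is a continuous image of the product of \<open>{0..1}\<close> with the
  hull of \<open>S\<close>.\<close>

lemma compact_convex_hull_finite:
  assumes "finite (S :: 'a set)"
  shows "compact (convex hull S)"
  using assms
proof (induction S rule: finite_induct)
  case (insert a S)
  show ?case
  proof (cases "S = {}")
    case False
    have "convex hull insert a S =
        (\<lambda>z. fst z *\<^sub>R a + (1 - fst z) *\<^sub>R snd z) ` ({0..1} \<times> (convex hull S))"
      unfolding convex_hull_insert[OF False]
    proof (intro equalityI subsetI)
      fix x assume "x \<in> {x. \<exists>u\<ge>0. \<exists>v\<ge>0. \<exists>b. u + v = 1 \<and> b \<in> convex hull S \<and> x = u *\<^sub>R a + v *\<^sub>R b}"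
      then obtain u v b where "u \<ge> 0" "v \<ge> 0" "u + v = 1" "b \<in> convex hull S" "x = u *\<^sub>R a + v *\<^sub>R b"
        by blast
      moreover from this have "v = 1 - u" by simp
      ultimately show "x \<in> (\<lambda>z. fst z *\<^sub>R a + (1 - fst z) *\<^sub>R snd z) ` ({0..1} \<times> (convex hull S))"
        by (intro image_eqI[of _ _ "(u, b)"]) auto
    next
      fix x assume "x \<in> (\<lambda>z. fst z *\<^sub>R a + (1 - fst z) *\<^sub>R snd z) ` ({0..1} \<times> (convex hull S))"
      then obtain u b where "0 \<le> u" "u \<le> 1" "b \<in> convex hull S" "x = u *\<^sub>R a + (1 - u) *\<^sub>R b"
        by auto
      then show "x \<in> {x. \<exists>u\<ge>0. \<exists>v\<ge>0. \<exists>b. u + v = 1 \<and> b \<in> convex hull S \<and> x = u *\<^sub>R a + v *\<^sub>R b}"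
        by (intro CollectI exI[of _ u] exI[of _ "1 - u"] exI[of _ b] conjI) auto
    qed
    moreover have "compact ({0..1::real} \<times> (convex hull S))"
      by (intro compact_Times insert.IH compact_Icc)
    moreover have "continuous_on ({0..1::real} \<times> (convex hull S))
        (\<lambda>z. fst z *\<^sub>R a + (1 - fst z) *\<^sub>R snd z)"
      unfolding continuous_on_def
      by (intro ballI tendsto_add_lcs tendsto_scaleR_lcs tendsto_intros)
    ultimately show ?thesis
      by (simp only:) (rule compact_continuous_image)
  qed simp
qed simp

text \<open>The one-sided bound suffices because exchanging \<open>x\<close> and \<open>y\<close>
  gives the other side. It covers distances to sets as well as distances to points.\<close>

lemma continuous_on_seminorm_lipschitz:
  assumes i: "i \<in> I" and g: "\<And>x y. g x \<le> p i (x - y) + g y"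
  shows "continuous_on S (g :: 'a \<Rightarrow> real)"
  unfolding continuous_on_def
proof
  fix x assume "x \<in> S"
  have "((\<lambda>y. y) \<longlongrightarrow> x) (at x within S)"
    by (rule tendsto_ident_at)
  then have "((\<lambda>y. p i (x - y)) \<longlongrightarrow> 0) (at x within S)"
    using i by (simp add: tendsto_seminorm_iff)
  then have "((\<lambda>y. g y - g x) \<longlongrightarrow> 0) (at x within S)"
  proof (rule Lim_null_comparison[rotated], intro always_eventually allI)
    fix y
    show "norm (g y - g x) \<le> p i (x - y)"
      using g[of x y] g[of y x] by (simp add: seminorm_minus_commute[OF i, of y x] abs_le_iff)
  qed
  then show "(g \<longlongrightarrow> g x) (at x within S)"
    using LIM_zero_cancel by blast
qed

section \<open>Distances to sets and the Hausdorff pseudometrics\<close>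

lemma dist_to_set_le:
  assumes "i \<in> I" "y \<in> A"
  shows "dist_to_set p i x A \<le> p i (x - y)"
  unfolding dist_to_set_def seminorm_dist_def
  by (rule cINF_lower[OF _ assms(2)]) (auto intro!: bdd_belowI2[of _ 0] seminorm_nonneg assms)

lemma dist_to_set_less_iff:
  assumes "i \<in> I" "A \<noteq> {}"
  shows "dist_to_set p i x A < e \<longleftrightarrow> (\<exists>y\<in>A. p i (x - y) < e)"
  unfolding dist_to_set_def seminorm_dist_def
  by (rule cINF_less_iff[OF assms(2)]) (auto intro!: bdd_belowI2[of _ 0] seminorm_nonneg assms)

lemma dist_to_set_lipschitz:
  assumes i: "i \<in> I" and A: "A \<noteq> {}"
  shows "dist_to_set p i x A \<le> p i (x - y) + dist_to_set p i y A"
proof (rule field_le_epsilon)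
  fix e :: real assume "e > 0"
  then obtain a where "a \<in> A" "p i (y - a) < dist_to_set p i y A + e"
    using dist_to_set_less_iff[OF i A, of y "dist_to_set p i y A + e"] by auto
  then show "dist_to_set p i x A \<le> p i (x - y) + dist_to_set p i y A + e"
    using dist_to_set_le[OF i \<open>a \<in> A\<close>, of x] seminorm_diff_triangle[OF i, of x a y] by linarith
qed

text \<open>Points of \<open>A\<close> close to \<open>x\<close> and to \<open>y\<close>, combined
  with the same weights, give a point close to the combination; convexity keeps it in
  \<open>A\<close>.\<close>

lemma convex_dist_to_set_less:
  assumes i: "i \<in> I" and A: "A \<noteq> {}" "convex A"
  shows "convex {x. dist_to_set p i x A < e}"
proof (rule convexI)
  fix x y and u v :: real
  assume "x \<in> {x. dist_to_set p i x A < e}" "y \<in> {x. dist_to_set p i x A < e}"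
    and uv: "0 \<le> u" "0 \<le> v" "u + v = 1"
  then obtain a b where ab: "a \<in> A" "b \<in> A" "p i (x - a) < e" "p i (y - b) < e"
    by (auto simp: dist_to_set_less_iff i A)
  have "(u *\<^sub>R x + v *\<^sub>R y) - (u *\<^sub>R a + v *\<^sub>R b) = u *\<^sub>R (x - a) + v *\<^sub>R (y - b)"
    by (simp add: algebra_simps)
  then have "p i ((u *\<^sub>R x + v *\<^sub>R y) - (u *\<^sub>R a + v *\<^sub>R b)) \<le> u * p i (x - a) + v * p i (y - b)"
    using seminorm_triangle[OF i, of "u *\<^sub>R (x - a)" "v *\<^sub>R (y - b)"] uv
    by (simp add: seminorm_scaleR[OF i])
  also have "\<dots> < e"
    using ab uv by (intro convex_bound_lt)
  finally have "p i ((u *\<^sub>R x + v *\<^sub>R y) - (u *\<^sub>R a + v *\<^sub>R b)) < e" .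
  moreover have "u *\<^sub>R a + v *\<^sub>R b \<in> A"
    using A(2) ab uv by (intro convexD)
  ultimately show "u *\<^sub>R x + v *\<^sub>R y \<in> {x. dist_to_set p i x A < e}"
    by (auto simp: dist_to_set_less_iff i A)
qed

lemma convex_dist_to_set_le:
  assumes "i \<in> I" "A \<noteq> {}" "convex A"
  shows "convex {x. dist_to_set p i x A \<le> e}"
proof -
  have "{x. dist_to_set p i x A \<le> e} = (\<Inter>d\<in>{0<..}. {x. dist_to_set p i x A < e + d})"
    by (auto intro: field_le_epsilon less_imp_le)
  then show ?thesis
    using convex_dist_to_set_less[OF assms] by (simp add: convex_INT)
qed

lemma closed_dist_to_set_le:
  assumes "i \<in> I" "A \<noteq> {}"
  shows "closed {x. dist_to_set p i x A \<le> e}"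
proof -
  have "continuous_on UNIV (\<lambda>x. dist_to_set p i x A)"
    using assms(1) by (rule continuous_on_seminorm_lipschitz) (rule dist_to_set_lipschitz[OF assms])
  then show ?thesis
    by (intro closed_Collect_le continuous_on_const)
qed

text \<open>Otherwise the complement of \<open>A\<close> contains a seminorm ball about
  \<open>x\<close>, so one seminorm already keeps \<open>x\<close> away from \<open>A\<close>. For
  empty \<open>I\<close> the only neighbourhood is the whole space, which would make
  \<open>A\<close> empty.\<close>

lemma mem_closed_dist_to_set:
  assumes A: "closed A" "A \<noteq> {}" and x: "\<And>i e. i \<in> I \<Longrightarrow> e > 0 \<Longrightarrow> dist_to_set p i x A < e"
  shows "x \<in> A"
proof (rule ccontr)
  assume "x \<notin> A"
  then have "eventually (\<lambda>y. y \<in> - A) (nhds x)"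
    using A by (intro eventually_nhds_in_open) auto
  then show False
    unfolding eventually_nhds_seminorm using A x
    by (auto simp: dist_to_set_less_iff split: if_splits)
qed

text \<open>The centres are taken in \<open>S\<close> itself, so that for convex \<open>S\<close>
  their convex combinations stay inside.\<close>

lemma compact_finite_seminorm_net:
  assumes S: "compact S" and i: "i \<in> I" and e: "e > 0"
  shows "\<exists>F. finite F \<and> F \<subseteq> S \<and> (\<forall>y\<in>S. \<exists>x\<in>F. p i (x - y) < e)"
proof -
  have "continuous_on UNIV (\<lambda>y. p i (y - x))" for x
    using i by (rule continuous_on_seminorm_lipschitz) (rule seminorm_diff_triangle[OF i])
  then have "open {y. p i (y - x) < e}" for x
    by (intro open_Collect_less continuous_on_const)
  moreover have "S \<subseteq> (\<Union>x\<in>S. {y. p i (y - x) < e})"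
    using e by (auto simp: seminorm_zero[OF i])
  ultimately obtain F where F: "F \<subseteq> S" "finite F" "S \<subseteq> (\<Union>x\<in>F. {y. p i (y - x) < e})"
    by (rule compactE_image[OF S])
  have "\<exists>x\<in>F. p i (x - y) < e" if y: "y \<in> S" for y
  proof -
    obtain x where "x \<in> F" "p i (y - x) < e"
      using y F(3) by blast
    then show ?thesis
      by (metis seminorm_minus_commute[OF i])
  qed
  with F(1,2) show ?thesis
    by blast
qed

text \<open>The way from \<open>z\<close> to \<open>A\<close> leads through an almost nearest point
  of \<open>B\<close>. This turns Hausdorff continuity of a multi-function into continuity of real
  functions.\<close>

lemma dist_to_set_le_hausdorff:
  assumes i: "i \<in> I" and A: "compact A" "A \<noteq> {}" and B: "compact B" "B \<noteq> {}"
  shows "\<bar>dist_to_set p i z A - dist_to_set p i z B\<bar> \<le> hausdorff_pdist p i A B"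
proof -
  have *: "dist_to_set p i z A \<le> dist_to_set p i z B + (SUP b\<in>B. dist_to_set p i b A)"
    if A: "compact A" "A \<noteq> {}" and B: "compact B" "B \<noteq> {}" for A B
  proof (rule field_le_epsilon)
    fix e :: real assume "e > 0"
    then obtain b where b: "b \<in> B" "p i (z - b) < dist_to_set p i z B + e"
      using dist_to_set_less_iff[OF i B(2), of z "dist_to_set p i z B + e"] by auto
    have "continuous_on B (\<lambda>x. dist_to_set p i x A)"
      using i by (rule continuous_on_seminorm_lipschitz) (rule dist_to_set_lipschitz[OF i A(2)])
    \<comment> \<open>Compactness matters here: a real supremum bounds its set only when the set is
      bounded above.\<close>
    then have "bdd_above ((\<lambda>x. dist_to_set p i x A) ` B)"
      using B(1) by (intro bounded_imp_bdd_above compact_imp_bounded compact_continuous_image)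
    then have "dist_to_set p i b A \<le> (SUP b\<in>B. dist_to_set p i b A)"
      using b(1) by (rule cSUP_upper[rotated])
    then show "dist_to_set p i z A \<le> dist_to_set p i z B + (SUP b\<in>B. dist_to_set p i b A) + e"
      using dist_to_set_lipschitz[OF i A(2), of z b] b(2) by linarith
  qed
  show ?thesis
    using *[OF A B] *[OF B A] by (simp add: hausdorff_pdist_def abs_le_iff) linarith
qed

lemma hausdorff_pdist_self:
  assumes i: "i \<in> I" and A: "A \<noteq> {}"
  shows "hausdorff_pdist p i A A = 0"
proof -
  have "dist_to_set p i x A = 0" if "x \<in> A" for x
  proof (rule antisym)
    show "dist_to_set p i x A \<le> 0"
      using dist_to_set_le[OF i that, of x] by (simp add: seminorm_zero[OF i])
    show "0 \<le> dist_to_set p i x A"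
      unfolding dist_to_set_def seminorm_dist_def
      by (intro cINF_greatest A seminorm_nonneg i)
  qed
  then show ?thesis
    using A by (simp add: hausdorff_pdist_def cong: SUP_cong_simp)
qed

end

section \<open>A compact convex invariant set\<close>

text \<open>Intersect all closed convex invariant subsets of \<open>D\<close> that contain
  \<open>x0\<close>. For minimality it is enough that \<open>N\<close> contains the image of
  \<open>C\<close>: then \<open>C\<close> intersected with \<open>N\<close> is again invariant,
  hence contains \<open>C\<close>.\<close>

lemma minimal_closed_convex_invariant:
  fixes D :: "'a::{real_vector, topological_space} set"
  assumes "closed D" "convex D" "x0 \<in> D" and T: "\<And>x. x \<in> D \<Longrightarrow> T x \<subseteq> D"
  obtains C where "C \<subseteq> D" "closed C" "convex C" "x0 \<in> C" "\<And>x. x \<in> C \<Longrightarrow> T x \<subseteq> C"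
    "\<And>N. closed N \<Longrightarrow> convex N \<Longrightarrow> x0 \<in> N \<Longrightarrow> (\<Union>x\<in>C. T x) \<subseteq> N \<Longrightarrow> C \<subseteq> N"
proof -
  define \<S> where "\<S> = {C. C \<subseteq> D \<and> closed C \<and> convex C \<and> x0 \<in> C \<and> (\<forall>x\<in>C. T x \<subseteq> C)}"
  have D: "D \<in> \<S>"
    using assms by (auto simp: \<S>_def)
  have inv: "T x \<subseteq> \<Inter>\<S>" if "x \<in> \<Inter>\<S>" for x
  proof (rule Inter_greatest)
    fix C assume "C \<in> \<S>"
    moreover from this have "x \<in> C"
      using that by blast
    ultimately show "T x \<subseteq> C"
      unfolding \<S>_def by blast
  qed
  have closed_conv: "closed (\<Inter>\<S>)" "convex (\<Inter>\<S>)" "x0 \<in> \<Inter>\<S>"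
    by (auto simp: \<S>_def intro!: closed_Inter convex_Inter)
  show thesis
  proof (rule that[of "\<Inter>\<S>"])
    fix N assume N: "closed N" "convex N" "x0 \<in> N" "(\<Union>x\<in>\<Inter>\<S>. T x) \<subseteq> N"
    have "T x \<subseteq> \<Inter>\<S> \<inter> N" if "x \<in> \<Inter>\<S> \<inter> N" for x
      using N(4) inv that by blast
    moreover have "\<Inter>\<S> \<inter> N \<subseteq> D"
      using D by blast
    moreover have "closed (\<Inter>\<S> \<inter> N)" "convex (\<Inter>\<S> \<inter> N)" "x0 \<in> \<Inter>\<S> \<inter> N"
      using N closed_conv by (auto intro: closed_Int convex_Int)
    ultimately have "\<Inter>\<S> \<inter> N \<in> \<S>"
      unfolding \<S>_def by blast
    then show "\<Inter>\<S> \<subseteq> N" by blast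
  qed (use D inv closed_conv in blast)+
qed

context saturated_lcs
begin

lemma finite_subset_dominating_seminorm:
  assumes "finite J" "J \<subseteq> I" "J \<noteq> {}"
  shows "\<exists>k\<in>I. \<forall>j\<in>J. \<forall>x y. p j (x - y) \<le> p k (x - y)"
  using assms(1,3,2)
proof (induction J rule: finite_ne_induct)
  case (insert j J)
  then obtain k where "k \<in> I" and k: "\<forall>j\<in>J. \<forall>x y. p j (x - y) \<le> p k (x - y)"
    by auto
  with insert.prems obtain l where "l \<in> I"
    "\<forall>x y. max (seminorm_dist p j x y) (seminorm_dist p k x y) \<le> seminorm_dist p l x y"
    using saturated[of j k] by auto
  then show ?case
    using k unfolding seminorm_dist_def max.bounded_iff by (metis insert_iff order_trans)
qed auto

text \<open>Used with \<open>B\<close> the image of the minimal set \<open>C\<close>. A cover of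
  \<open>B\<close> by balls of radius \<open>e / 2\<close> puts \<open>B\<close> in a closed
  neighbourhood of the hull of the centres and \<open>x0\<close>; \<open>C\<close> lies there too,
  and compactness of the hull turns this back into a finite cover.\<close>

lemma noncompactness_le_of_minimal:
  assumes min: "\<And>N. closed N \<Longrightarrow> convex N \<Longrightarrow> x0 \<in> N \<Longrightarrow> B \<subseteq> N \<Longrightarrow> C \<subseteq> N"
  shows "noncompactness I p C \<le> noncompactness I p B"
  unfolding noncompactness_def[of I p B]
proof (rule Inf_greatest)
  fix a assume "a \<in> {ennreal e |e. e > 0 \<and>
      (\<forall>i\<in>I. \<exists>F. finite F \<and> B \<subseteq> (\<Union>x\<in>F. seminorm_ball p i x (e / 2)))}"
  then obtain e where a: "a = ennreal e" and "e > 0"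
    and cover: "\<And>i. i \<in> I \<Longrightarrow> \<exists>F. finite F \<and> B \<subseteq> (\<Union>x\<in>F. seminorm_ball p i x (e / 2))"
    by blast
  show "noncompactness I p C \<le> a"
  proof (rule ennreal_le_epsilon)
    \<comment> \<open>The slack splits as \<open>e / 2 + d / 4 + d / 4 = (e + d) / 2\<close>: one
      \<open>d / 4\<close> pays for the passage from \<open>\<le>\<close> to strict inequality, the
      other for the finite net of the hull.\<close>
    fix d :: real assume "d > 0"
    have "\<exists>F. finite F \<and> C \<subseteq> (\<Union>x\<in>F. seminorm_ball p i x ((e + d) / 2))" if i: "i \<in> I" for i
    proof -
      obtain F where F: "finite F" "B \<subseteq> (\<Union>x\<in>F. seminorm_ball p i x (e / 2))"
        using cover[OF i] by blast
      \<comment> \<open>Adding \<open>x0\<close> to the centres places \<open>x0\<close> in the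
        neighbourhood and keeps \<open>K\<close> nonempty even for empty \<open>F\<close>.\<close>
      define K where "K = convex hull (insert x0 F)"
      have K: "compact K" "convex K" "insert x0 F \<subseteq> K"
        using F(1) hull_subset[of "insert x0 F" convex]
        by (auto simp: K_def intro: compact_convex_hull_finite)
      then have "K \<noteq> {}" by blast
      have "C \<subseteq> {z. dist_to_set p i z K \<le> e / 2}"
      proof (rule min)
        have "dist_to_set p i x0 K \<le> p i (x0 - x0)"
          using K(3) by (intro dist_to_set_le i) auto
        then show "x0 \<in> {z. dist_to_set p i z K \<le> e / 2}"
          using \<open>e > 0\<close> by (simp add: seminorm_zero[OF i])
        show "B \<subseteq> {z. dist_to_set p i z K \<le> e / 2}"
        proof
          fix z assume "z \<in> B"
          then obtain x where "x \<in> F" "p i (z - x) < e / 2"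
            using F(2) by (auto simp: seminorm_ball_def seminorm_dist_def
                seminorm_minus_commute[OF i, of _ z])
          moreover from this have "dist_to_set p i z K \<le> p i (z - x)"
            using K(3) by (intro dist_to_set_le i) auto
          ultimately show "z \<in> {z. dist_to_set p i z K \<le> e / 2}"
            by simp
        qed
      qed (use \<open>K \<noteq> {}\<close> K(2) i in \<open>blast intro: closed_dist_to_set_le convex_dist_to_set_le\<close>)+
      moreover obtain M where M: "finite M" "\<And>y. y \<in> K \<Longrightarrow> \<exists>x\<in>M. p i (x - y) < d / 4"
        using compact_finite_seminorm_net[OF K(1) i, of "d / 4"] \<open>d > 0\<close> by auto
      have "z \<in> (\<Union>x\<in>M. seminorm_ball p i x ((e + d) / 2))" if "dist_to_set p i z K \<le> e / 2" for z
      proof -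
        have "dist_to_set p i z K < e / 2 + d / 4"
          using that \<open>d > 0\<close> by simp
        then obtain y where y: "y \<in> K" "p i (z - y) < e / 2 + d / 4"
          using \<open>K \<noteq> {}\<close> by (auto simp: dist_to_set_less_iff i)
        then obtain x where x: "x \<in> M" "p i (x - y) < d / 4"
          using M(2) by blast
        have "p i (x - z) \<le> p i (x - y) + p i (z - y)"
          using seminorm_diff_triangle[OF i, of x z y] by (simp add: seminorm_minus_commute[OF i, of y z])
        also have "\<dots> < (e + d) / 2"
          using x(2) y(2) \<open>d > 0\<close> by argo
        finally show ?thesis
          using x(1) by (auto simp: seminorm_ball_def seminorm_dist_def)
      qed
      ultimately show ?thesis
        using M(1) by (intro exI[of _ M]) blast
    qed
    then have "noncompactness I p C \<le> ennreal (e + d)"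
      unfolding noncompactness_def using \<open>e > 0\<close> \<open>d > 0\<close>
      by (intro Inf_lower CollectI exI[of _ "e + d"]) auto
    then show "noncompactness I p C \<le> a + ennreal d"
      using \<open>e > 0\<close> \<open>d > 0\<close> by (simp add: a ennreal_plus)
  qed
qed

lemma totally_bounded_if_noncompactness_eq_0:
  assumes "noncompactness I p A = 0"
  shows "totally_bounded A"
  unfolding totally_bounded_def
proof (intro allI impI)
  fix E assume E: "eventually E (uniformity :: ('a \<times> 'a) filter)"
  show "\<exists>X. finite X \<and> (\<forall>s\<in>A. \<exists>x\<in>X. E (x, s))"
  proof (cases "I = {}")
    case True
    \<comment> \<open>With no seminorms every entourage is the full relation, so any single centre
      works.\<close>
    then show ?thesis
      using E by (intro exI[of _ "{0}"]) (simp add: eventually_uniformity_seminorm)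
  next
    case False
    then obtain i e where i: "i \<in> I" and "e > 0" and e: "\<And>x y. p i (x - y) < e \<Longrightarrow> E (x, y)"
      using E by (auto simp: eventually_uniformity_seminorm)
    have "noncompactness I p A < ennreal e"
      using assms \<open>e > 0\<close> by simp
    then obtain d where "d > 0" "ennreal d < ennreal e"
      and cover: "\<And>i. i \<in> I \<Longrightarrow> \<exists>F. finite F \<and> A \<subseteq> (\<Union>x\<in>F. seminorm_ball p i x (d / 2))"
      unfolding noncompactness_def Inf_less_iff by blast
    have "d / 2 < e"
      using \<open>d > 0\<close> \<open>ennreal d < ennreal e\<close> by (simp add: ennreal_less_iff)
    obtain F where F: "finite F" "A \<subseteq> (\<Union>x\<in>F. seminorm_ball p i x (d / 2))"
      using cover[OF i] by blast
    have "\<exists>x\<in>F. E (x, s)" if s: "s \<in> A" for s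
    proof -
      obtain x where "x \<in> F" "s \<in> seminorm_ball p i x (d / 2)"
        using F(2) s by blast
      then show ?thesis
        using e[of x s] \<open>d / 2 < e\<close> by (auto simp: seminorm_ball_def seminorm_dist_def)
    qed
    with F(1) show ?thesis by blast
  qed
qed

text \<open>For the minimal set \<open>C\<close> the estimate
  \<open>\<alpha>(C) \<le> \<alpha>(T(C))\<close> excludes strict decrease, so condensing leaves
  only measure 0. Completeness of \<open>D\<close> then upgrades the closed totally bounded
  \<open>C\<close> to a compact set.\<close>

lemma condensing_imp_compact_invariant:
  assumes "complete D" "closed D" "convex D" "D \<noteq> {}" "unif_bounded D"
    and T: "T \<in> D \<rightarrow> compact_convex_subsets D" and cond: "condensing I p D T"
  obtains C where "C \<subseteq> D" "C \<noteq> {}" "compact C" "convex C" "\<And>x. x \<in> C \<Longrightarrow> T x \<subseteq> C"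
proof -
  obtain x0 where "x0 \<in> D"
    using \<open>D \<noteq> {}\<close> by blast
  moreover have "T x \<subseteq> D" if "x \<in> D" for x
    using T that by (auto simp: compact_convex_subsets_def)
  ultimately obtain C where C: "C \<subseteq> D" "closed C" "convex C" "x0 \<in> C" "\<And>x. x \<in> C \<Longrightarrow> T x \<subseteq> C"
    and min: "\<And>N. closed N \<Longrightarrow> convex N \<Longrightarrow> x0 \<in> N \<Longrightarrow> (\<Union>x\<in>C. T x) \<subseteq> N \<Longrightarrow> C \<subseteq> N"
    using minimal_closed_convex_invariant[of D x0 T] assms(2,3) by metis
  have "noncompactness I p C \<le> noncompactness I p (\<Union>x\<in>C. T x)"
    using min by (rule noncompactness_le_of_minimal)
  moreover have "unif_bounded C"
    using \<open>unif_bounded D\<close> \<open>C \<subseteq> D\<close> unfolding unif_bounded_def by (meson order_trans)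
  ultimately have "noncompactness I p C = 0"
    using cond \<open>C \<subseteq> D\<close> unfolding condensing_def by (metis gr_zeroI leD)
  then have "compact C"
    using complete_closed_subset[OF assms(1) C(2,1)]
    by (intro complete_totally_bounded_imp_compact totally_bounded_if_noncompactness_eq_0)
  with C show thesis
    by (intro that[of C]) auto
qed

text \<open>A Hausdorff ball about \<open>T x\<close> is a generator of the topology, so its
  preimage is relatively open around \<open>x\<close>; inside it the distances from \<open>z\<close>
  to \<open>T y\<close> and to \<open>T x\<close> differ by less than \<open>e\<close>.\<close>

lemma condensing_imp_continuous_dist:
  assumes T: "T \<in> D \<rightarrow> compact_convex_subsets D" and cond: "condensing I p D T" and i: "i \<in> I"
  shows "continuous_on D (\<lambda>x. dist_to_set p i z (T x))"
  unfolding continuous_on_def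
proof (intro ballI tendstoI)
  fix x and e :: real assume x: "x \<in> D" and "e > 0"
  let ?U = "{B \<in> compact_convex_subsets D. hausdorff_pdist p i (T x) B < e}"
  have Tx: "T y \<in> compact_convex_subsets D" if "y \<in> D" for y
    using T that by blast
  have "openin (hausdorff_topology I p D) ?U"
    unfolding hausdorff_topology_def using Tx[OF x] i \<open>e > 0\<close>
    by (intro topology_generated_by_Basis) blast
  moreover have "continuous_map (top_of_set D) (hausdorff_topology I p D) T"
    using cond by (simp add: condensing_def)
  ultimately have "openin (top_of_set D) {y \<in> D. T y \<in> ?U}"
    using openin_continuous_map_preimage by fastforce
  then obtain O' where "open O'" and O': "{y \<in> D. T y \<in> ?U} = D \<inter> O'"
    by (auto simp: openin_open)
  have "x \<in> {y \<in> D. T y \<in> ?U}"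
    using x Tx[OF x] \<open>e > 0\<close>
    by (simp add: hausdorff_pdist_self[OF i] compact_convex_subsets_def)
  then have "x \<in> O'"
    using O' by blast
  then have "eventually (\<lambda>y. y \<in> O') (at x within D)"
    using eventually_nhds_in_open[OF \<open>open O'\<close>, of x]
    by (simp add: eventually_at_filter eventually_mono)
  moreover have "eventually (\<lambda>y. y \<in> D) (at x within D)"
    by (simp add: eventually_at_filter)
  ultimately show "eventually (\<lambda>y. dist (dist_to_set p i z (T y)) (dist_to_set p i z (T x)) < e) (at x within D)"
  proof eventually_elim
    case (elim y)
    then have "hausdorff_pdist p i (T x) (T y) < e"
      using O' by blast
    then show ?case
      using dist_to_set_le_hausdorff[OF i, of "T x" "T y" z] Tx[OF x] Tx[OF elim(2)]
      by (simp add: dist_real_def compact_convex_subsets_def)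
  qed
qed

end

section \<open>Fixed points\<close>

context saturated_lcs
begin

text \<open>Brouwer's theorem is applied on the space of weights, to \<open>\<psi>\<close> after
  \<open>h\<close>, rather than on \<open>K\<close>. The fixed point gives \<open>x\<close> as a
  combination of nodes \<open>y j\<close>, and only nodes within \<open>e\<close> of
  \<open>T x\<close> carry weight. Points so close to the convex set \<open>T x\<close> form a
  convex set, which therefore contains \<open>x\<close>.\<close>

lemma approximate_fixed_point:
  assumes K: "compact K" "convex K" "K \<noteq> {}" and i: "i \<in> I" and e: "e > 0"
    and T: "\<And>x. x \<in> K \<Longrightarrow> T x \<subseteq> K \<and> T x \<noteq> {} \<and> convex (T x)"
    and cont: "\<And>z. continuous_on K (\<lambda>x. dist_to_set p i z (T x))"
  shows "\<exists>x\<in>K. dist_to_set p i x (T x) < e"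
proof -
  obtain M where M: "finite M" "M \<subseteq> K" "\<And>y. y \<in> K \<Longrightarrow> \<exists>x\<in>M. p i (x - y) < e"
    using compact_finite_seminorm_net[OF K(1) i e] by blast
  then have "M \<noteq> {}"
    using K(3) by blast
  define n where "n = card M"
  have "n > 0"
    using M(1) \<open>M \<noteq> {}\<close> by (simp add: n_def card_gt_0_iff)
  obtain y where y: "bij_betw y {0..<n} M"
    using ex_bij_betw_nat_finite[OF M(1)] n_def by blast
  then have yM: "y ` {..<n} = M"
    by (simp add: bij_betw_def lessThan_atLeast0)
  then have yK: "y j \<in> K" if "j < n" for j
    using that M(2) by blast
  \<comment> \<open>\<open>\<phi> j\<close> is positive exactly where the node \<open>y j\<close> is
    closer than \<open>e\<close> to \<open>T x\<close>; dividing by the sum gives a partition of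
    unity on \<open>K\<close>.\<close>
  define \<phi> where "\<phi> j x = max 0 (e - dist_to_set p i (y j) (T x))" for j x
  define \<Phi> where "\<Phi> x = (\<Sum>j<n. \<phi> j x)" for x
  define \<psi> where "\<psi> x j = (if j < n then \<phi> j x / \<Phi> x else 0)" for x j
  have \<phi>_nonneg: "0 \<le> \<phi> j x" for j x
    by (simp add: \<phi>_def)
  have \<Phi>_pos: "\<Phi> x > 0" if x: "x \<in> K" for x
  proof -
    obtain z where z: "z \<in> T x" "z \<in> K"
      using T[OF x] by blast
    then obtain j where j: "j < n" "p i (y j - z) < e"
      using M(3)[of z] yM by blast
    then have "dist_to_set p i (y j) (T x) < e"
      using dist_to_set_le[OF i z(1), of "y j"] by linarith
    then have "\<phi> j x > 0"
      by (simp add: \<phi>_def)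
    then show ?thesis
      unfolding \<Phi>_def using j(1) \<phi>_nonneg by (intro sum_pos2[of _ j]) auto
  qed
  have \<psi>_cont: "continuous_on K (\<lambda>x. \<psi> x j)" for j
  proof (cases "j < n")
    case True
    have "continuous_on K (\<lambda>x. \<phi> k x)" for k
      unfolding \<phi>_def by (intro continuous_intros cont)
    then have "continuous_on K (\<lambda>x. \<phi> j x / \<Phi> x)"
      unfolding \<Phi>_def using \<Phi>_pos[unfolded \<Phi>_def]
      by (intro continuous_intros) (metis less_irrefl)+
    then show ?thesis
      using True by (simp add: \<psi>_def)
  qed (simp add: \<psi>_def)
  have \<psi>_sum: "(\<Sum>j<n. \<psi> x j) = 1" if "x \<in> K" for x
    using \<Phi>_pos[OF that] by (simp add: \<psi>_def flip: sum_divide_distrib) (simp add: \<Phi>_def)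
  have \<psi>_nonneg: "0 \<le> \<psi> x j" if "x \<in> K" for x j
    using \<Phi>_pos[OF that] \<phi>_nonneg by (simp add: \<psi>_def)
  have \<psi>_cube: "\<psi> x \<in> nat_cube n" if x: "x \<in> K" for x
  proof -
    have "\<psi> x j \<le> 1" if "j < n" for j
      using member_le_sum[of j "{..<n}" "\<psi> x"] that \<psi>_nonneg[OF x] \<psi>_sum[OF x] by simp
    moreover have "\<psi> x j = 0" if "j \<ge> n" for j
      using that by (simp add: \<psi>_def)
    ultimately show ?thesis
      using \<psi>_nonneg[OF x] by (simp add: nat_cube_def)
  qed

  txt \<open>\<open>r\<close> retracts the cube onto the simplex of weights, which contains the values of \<open>\<psi>\<close>.\<close>
  define s where "s t = (\<Sum>j<n. t j)" for t :: "nat \<Rightarrow> real"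
  define r where "r t j = t j / max 1 (s t) + max 0 (1 - s t) / n" for t j
  have r_sum: "(\<Sum>j<n. r t j) = 1" for t
  proof -
    have "(\<Sum>j<n. r t j) = s t / max 1 (s t) + max 0 (1 - s t)"
      using \<open>n > 0\<close> by (simp add: r_def sum.distrib s_def flip: sum_divide_distrib)
    also have "\<dots> = 1"
      by (cases "s t \<le> 1") auto
    finally show ?thesis .
  qed
  have r_nonneg: "0 \<le> r t j" if "t \<in> nat_cube n" "j < n" for t j
    using that by (auto simp: r_def nat_cube_def)
  define h where "h t = (\<Sum>j<n. r t j *\<^sub>R y j)" for t
  have hK: "h t \<in> K" if "t \<in> nat_cube n" for t
    unfolding h_def using that r_nonneg yK r_sum by (intro convex_sum K(2)) auto
  have "continuous_on (nat_cube n) (\<lambda>t. t j)" for j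
    using continuous_on_product_coordinates by (rule continuous_on_subset) simp
  then have r_cont: "continuous_on (nat_cube n) (\<lambda>t. r t j)" for j
    unfolding r_def s_def using \<open>n > 0\<close> by (intro continuous_intros) auto
  then have "continuous_on (nat_cube n) h"
    unfolding h_def continuous_on_def
    by (intro ballI tendsto_sum_lcs tendsto_scaleR_lcs tendsto_const) blast
  then have "continuous_on (nat_cube n) (\<lambda>t. \<psi> (h t))"
    by (intro continuous_on_coordinatewise_then_product continuous_on_compose2[OF \<psi>_cont])
      (use hK in auto)
  moreover have "(\<lambda>t. \<psi> (h t)) \<in> nat_cube n \<rightarrow> nat_cube n"
    using hK \<psi>_cube by blast
  ultimately obtain t where t: "t \<in> nat_cube n" "\<psi> (h t) = t"
    using brouwer_nat_cube by metis
  define x where "x = h t"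
  have x: "x \<in> K"
    unfolding x_def by (rule hK[OF t(1)])
  \<comment> \<open>The fixed point has coordinate sum 1, where the retraction \<open>r\<close> is
    the identity; hence \<open>x\<close> is the combination with the weights
    \<open>\<psi> x\<close>.\<close>
  have "s t = 1"
    using \<psi>_sum[OF x] t(2) by (simp add: s_def x_def)
  then have r_eq: "r t j = \<psi> x j" for j
    using t(2) by (simp add: r_def x_def)
  have x_eq: "(\<Sum>j<n. \<psi> x j *\<^sub>R y j) = x"
    by (simp only: r_eq[symmetric]) (simp only: x_def h_def)
  \<comment> \<open>Nodes of weight 0 may be far from \<open>T x\<close>, so they are dropped before
    convexity is used.\<close>
  define J where "J = {j\<in>{..<n}. \<psi> x j \<noteq> 0}"
  have "(\<Sum>j\<in>J. \<psi> x j *\<^sub>R y j) \<in> {z. dist_to_set p i z (T x) < e}"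
  proof (rule convex_sum)
    show "convex {z. dist_to_set p i z (T x) < e}"
      using T[OF x] i by (intro convex_dist_to_set_less) auto
    have "(\<Sum>j\<in>J. \<psi> x j) = (\<Sum>j<n. \<psi> x j)"
      unfolding J_def by (intro sum.mono_neutral_left) auto
    then show "(\<Sum>j\<in>J. \<psi> x j) = 1"
      using \<psi>_sum[OF x] by simp
    show "y j \<in> {z. dist_to_set p i z (T x) < e}" if "j \<in> J" for j
      using that by (auto simp: J_def \<psi>_def \<phi>_def max_def split: if_splits)
  qed (use \<psi>_nonneg[OF x] in \<open>auto simp: J_def\<close>)
  moreover have "(\<Sum>j\<in>J. \<psi> x j *\<^sub>R y j) = (\<Sum>j<n. \<psi> x j *\<^sub>R y j)"
    unfolding J_def by (intro sum.mono_neutral_left) auto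
  ultimately show ?thesis
    using x x_eq by auto
qed

text \<open>The approximate fixed points for one seminorm and one tolerance form a closed set.
  Saturation gives these sets the finite intersection property, so by compactness some
  \<open>x\<close> lies in all of them, and it has distance 0 from the closed set \<open>T x\<close>
  in each seminorm.\<close>

theorem kakutani_fan_glicksberg:
  assumes K: "compact K" "convex K" "K \<noteq> {}"
    and T: "\<And>x. x \<in> K \<Longrightarrow> T x \<subseteq> K \<and> T x \<noteq> {} \<and> closed (T x) \<and> convex (T x)"
    and cont: "\<And>i z. i \<in> I \<Longrightarrow> continuous_on K (\<lambda>x. dist_to_set p i z (T x))"
  shows "\<exists>x\<in>K. x \<in> T x"
proof -
  define Q where "Q z = {x\<in>K. dist_to_set p (fst z) x (T x) \<le> snd z}" for z :: "'i \<times> real"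
  have "K \<inter> (\<Inter>z\<in>I \<times> {0<..}. Q z) \<noteq> {}"
  proof (rule compact_imp_fip_image[OF K(1)])
    fix z assume "z \<in> I \<times> {0::real<..}"
    then have i: "fst z \<in> I" by auto
    have "continuous_on K (\<lambda>x. dist_to_set p (fst z) x (T x))"
      unfolding continuous_on_def
    proof
      fix x assume x: "x \<in> K"
      have "((\<lambda>w. w) \<longlongrightarrow> x) (at x within K)"
        by (rule tendsto_ident_at)
      then have "((\<lambda>w. p (fst z) (x - w)) \<longlongrightarrow> 0) (at x within K)"
        using i by (simp add: tendsto_seminorm_iff)
      \<comment> \<open>Both the point and the set move with \<open>w\<close>. The part due to the
        point is controlled by the Lipschitz bound; the part due to the set is the hypothesis
        \<open>cont\<close>.\<close>
      then have "((\<lambda>w. dist_to_set p (fst z) w (T w) - dist_to_set p (fst z) x (T w)) \<longlongrightarrow> 0) (at x within K)"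
      proof (rule Lim_null_comparison[rotated])
        have "eventually (\<lambda>w. w \<in> K) (at x within K)"
          by (simp add: eventually_at_filter)
        then show "\<forall>\<^sub>F w in at x within K.
            norm (dist_to_set p (fst z) w (T w) - dist_to_set p (fst z) x (T w)) \<le> p (fst z) (x - w)"
        proof eventually_elim
          case (elim w)
          then have "T w \<noteq> {}"
            using T by blast
          then show ?case
            using dist_to_set_lipschitz[OF i, of "T w" w x] dist_to_set_lipschitz[OF i, of "T w" x w]
            by (simp add: abs_le_iff seminorm_minus_commute[OF i, of w x])
        qed
      qed
      moreover have "((\<lambda>w. dist_to_set p (fst z) x (T w)) \<longlongrightarrow> dist_to_set p (fst z) x (T x)) (at x within K)"
        using cont[OF i] x by (auto simp: continuous_on_def)
      ultimately show "((\<lambda>w. dist_to_set p (fst z) w (T w)) \<longlongrightarrow> dist_to_set p (fst z) x (T x)) (at x within K)"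
        using tendsto_add by fastforce
    qed
    then show "closed (Q z)"
      unfolding Q_def using K(1)
      by (intro continuous_on_closed_Collect_le continuous_on_const compact_imp_closed)
  next
    fix Z assume Z: "finite Z" "Z \<subseteq> I \<times> {0::real<..}"
    show "K \<inter> (\<Inter>z\<in>Z. Q z) \<noteq> {}"
    proof (cases "Z = {}")
      case False
      have "finite (fst ` Z)" "fst ` Z \<subseteq> I" "fst ` Z \<noteq> {}"
        using Z False by auto
      \<comment> \<open>One dominating seminorm and the smallest tolerance handle the finitely many
        conditions at once.\<close>
      from finite_subset_dominating_seminorm[OF this]
      obtain k where k: "k \<in> I" "\<forall>j\<in>fst ` Z. \<forall>x y. p j (x - y) \<le> p k (x - y)"
        by blast
      define e where "e = Min (snd ` Z)"
      have "e > 0"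
        using Z False by (auto simp: e_def)
      have T': "T x \<subseteq> K \<and> T x \<noteq> {} \<and> convex (T x)" if "x \<in> K" for x
        using T[OF that] by blast
      obtain x where x: "x \<in> K" "dist_to_set p k x (T x) < e"
        using approximate_fixed_point[OF K k(1) \<open>e > 0\<close> T' cont[OF k(1)]] by blast
      moreover have Tx: "T x \<noteq> {}"
        using T x(1) by blast
      \<comment> \<open>The comparison of seminorms is pointwise, so it is carried over to distances
        from \<open>T x\<close> through one witness \<open>y\<close>.\<close>
      ultimately obtain y where y: "y \<in> T x" "p k (x - y) < e"
        using dist_to_set_less_iff[OF k(1)] by blast
      have "x \<in> Q z" if z: "z \<in> Z" for z
      proof -
        have "dist_to_set p (fst z) x (T x) \<le> p (fst z) (x - y)"
          using z Z(2) y(1) by (intro dist_to_set_le) auto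
        also have "\<dots> \<le> p k (x - y)"
          using z k(2) by blast
        also have "\<dots> \<le> e"
          using y(2) by simp
        also have "\<dots> \<le> snd z"
          unfolding e_def using z Z(1) by (intro Min_le) auto
        finally show ?thesis
          using x(1) by (simp add: Q_def)
      qed
      with x(1) show ?thesis by blast
    qed (use K in simp)
  qed
  then obtain x where x: "x \<in> K" and Q: "\<And>z. z \<in> I \<times> {0<..} \<Longrightarrow> x \<in> Q z"
    by blast
  have "x \<in> T x"
  proof (rule mem_closed_dist_to_set)
    fix i and e :: real assume "i \<in> I" "e > 0"
    \<comment> \<open>Halving \<open>e\<close> recovers the strict inequality, since
      \<open>Q\<close> only gives \<open>\<le>\<close>.\<close>
    then show "dist_to_set p i x (T x) < e"
      using Q[of "(i, e / 2)"] by (simp add: Q_def)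
  qed (use T[OF x] in auto)
  with x show ?thesis by blast
qed

end

text \<open>On the compact convex invariant set \<open>C\<close> the multi-function takes values
  inside \<open>C\<close>, so the fixed point theorem for compact sets applies to its
  restriction.\<close>

theorem theorem21:
  fixes scale :: "'k::real_normed_field \<Rightarrow> 'a::{real_vector, uniform_space, t2_space} \<Rightarrow> 'a"
    and I :: "'i set"
    and p :: "'i \<Rightarrow> 'a \<Rightarrow> real"
    and D :: "'a set"
    and T :: "'a \<Rightarrow> 'a set"
  assumes "saturated_lcs scale I p"
    and "D \<noteq> {}"
    and "unif_bounded D" and "closed D" and "convex D"
    and "complete D"
    and "T \<in> D \<rightarrow> compact_convex_subsets D"
    and "condensing I p D T"
  shows "\<exists>x\<in>D. x \<in> T x"
proof -
  interpret saturated_lcs scale I p by fact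
  obtain C where C: "C \<subseteq> D" "C \<noteq> {}" "compact C" "convex C" "\<And>x. x \<in> C \<Longrightarrow> T x \<subseteq> C"
    using condensing_imp_compact_invariant[OF \<open>complete D\<close> \<open>closed D\<close> \<open>convex D\<close> \<open>D \<noteq> {}\<close>
        \<open>unif_bounded D\<close> assms(7,8)] by metis
  have "\<exists>x\<in>C. x \<in> T x"
  proof (rule kakutani_fan_glicksberg[OF C(3,4,2)])
    fix x assume "x \<in> C"
    then have "T x \<in> compact_convex_subsets D"
      using C(1) assms(7) by blast
    then show "T x \<subseteq> C \<and> T x \<noteq> {} \<and> closed (T x) \<and> convex (T x)"
      using C(5)[OF \<open>x \<in> C\<close>] by (auto simp: compact_convex_subsets_def compact_imp_closed)
  next
    fix i z assume "i \<in> I"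
    then show "continuous_on C (\<lambda>x. dist_to_set p i z (T x))"
      using condensing_imp_continuous_dist[OF assms(7,8)] C(1) by (blast intro: continuous_on_subset)
  qed
  with C(1) show ?thesis by blast
qed

end
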